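(* Let $t$ be a term such that $t$ reduces by finitely many $\rhd\mathsf{shuf}$-steps to a value $v$. Then for every derivation $\pi$ with conclusion $\vdash t \colon \mathbf{0}$ (empty environment) and every reduction sequence $d$ from $t$ to its $\rhd\mathsf{shuf}$-normal form by $\rhd\mathsf{shuf}$-steps, the number of $\rhd\beta_v$-steps in $d$ equals $|\pi|$.
   Context: Terms: $t ::= x \mid \lambda x.t \mid tu$ (up to $\alpha$); values $v ::= x \mid \lambda x.t$; $\mathrm{Fv}(t)$ free variables; $t\{v/x\}$ substitution. Root steps: ($\beta_v$) $(\lambda x.t)v \mapsto t\{v/x\}$, $v$ a value; ($\sigma_1$) $(\lambda x.t)us \mapsto (\lambda x.ts)u$ if $x\notin\mathrm{Fv}(s)$; ($\sigma_3$) $v((\lambda x.s)u)\mapsto(\lambda x.vs)u$ if $v$ a value, $x\notin\mathrm{Fv}(v)$. Balanced contexts $B ::= [\cdot] \mid (\lambda x.B)t \mid Bt \mid tB$; $\rhd r$-reduction is the closure of root step $r$ under balanced contexts; $\rhd\mathsf{shuf}$ is the union of $\rhd\beta_v,\rhd\sigma_1,\rhd\sigma_3$ (it is confluent, so normal forms are unique). Types: positive types are finite multisets $[(P_1,Q_1),\dots,(P_n,Q_n)]$ of pairs of positive types ($\mathbf{0}$ empty, $\uplus$ union). Environments map variables to positive types (finitely many non-$\mathbf{0}$), combined pointwise by $\uplus$; an empty environment assigns $\mathbf{0}$ to all variables. Rules: (ax) $x\colon P\vdash x\colon P$; ($\lambda$) from $\Gamma_i,x\colon P_i\vdash t\colon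 Q_i$ ($1\le i\le n$, $n\ge0$) infer $\biguplus_i\Gamma_i\vdash\lambda x.t\colon[(P_1,Q_1),\dots,(P_n,Q_n)]$; ($@$) from $\Gamma\vdash t\colon[(P,Q)]$ and $\Delta\vdash u\colon P$ infer $\Gamma\uplus\Delta\vdash tu\colon Q$. The size $|\pi|$ of a derivation is the number of $@$ rules in it. *)

theory Defs
  imports "HOL-Library.Multiset" "HOL-Library.Function_Algebras"
begin

text \<open>Terms up to \<open>\<alpha>\<close>-equivalence are represented with de Bruijn indices.\<close>

datatype trm = Var nat | Lam trm | App trm trm

fun is_value :: "trm \<Rightarrow> bool" where
  "is_value (Var x) = True"
| "is_value (Lam t) = True"
| "is_value (App t u) = False"

primrec lift :: "nat \<Rightarrow> trm \<Rightarrow> trm" where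
  "lift k (Var i) = (if i < k then Var i else Var (Suc i))"
| "lift k (Lam t) = Lam (lift (Suc k) t)"
| "lift k (App t u) = App (lift k t) (lift k u)"

text \<open>\<open>subst t s k\<close> replaces index \<open>k\<close> by \<open>s\<close> in \<open>t\<close> and removes the binder of index \<open>k\<close>.\<close>

primrec subst :: "trm \<Rightarrow> trm \<Rightarrow> nat \<Rightarrow> trm" where
  "subst (Var i) s k = (if k < i then Var (i - 1) else if i = k then s else Var i)"
| "subst (Lam t) s k = Lam (subst t (lift 0 s) (Suc k))"
| "subst (App t u) s k = App (subst t s k) (subst u s k)"

datatype rule = BetaV | Sigma1 | Sigma3

text \<open>
  In the \<open>\<sigma>\<close>-rules the term that enters the scope of the abstraction is lifted; this
  expresses the side condition that the bound variable is not free in it.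
\<close>

inductive root :: "rule \<Rightarrow> trm \<Rightarrow> trm \<Rightarrow> bool" where
  beta_v: "is_value v \<Longrightarrow> root BetaV (App (Lam t) v) (subst t v 0)"
| sigma1: "root Sigma1 (App (App (Lam t) u) s) (App (Lam (App t (lift 0 s))) u)"
| sigma3: "is_value v \<Longrightarrow>
    root Sigma3 (App v (App (Lam s) u)) (App (Lam (App (lift 0 v) s)) u)"

datatype bctx = Hole | BLam bctx trm | BAppL bctx trm | BAppR trm bctx

primrec plug :: "bctx \<Rightarrow> trm \<Rightarrow> trm" where
  "plug Hole s = s"
| "plug (BLam B t) s = App (Lam (plug B s)) t"
| "plug (BAppL B t) s = App (plug B s) t"
| "plug (BAppR t B) s = App t (plug B s)"

definition step :: "rule \<Rightarrow> trm \<Rightarrow> trm \<Rightarrow> bool" where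
  "step r t u \<longleftrightarrow> (\<exists>B s s'. root r s s' \<and> t = plug B s \<and> u = plug B s')"

definition shuf :: "trm \<Rightarrow> trm \<Rightarrow> bool" where
  "shuf t u \<longleftrightarrow> step BetaV t u \<or> step Sigma1 t u \<or> step Sigma3 t u"

definition shuf_normal :: "trm \<Rightarrow> bool" where
  "shuf_normal t \<longleftrightarrow> (\<nexists>u. shuf t u)"

text \<open>
  A reduction sequence from a given term is the list of its steps, each recorded as the
  rule fired together with the reduct.
\<close>

fun red_seq :: "trm \<Rightarrow> (rule \<times> trm) list \<Rightarrow> trm \<Rightarrow> bool" where
  "red_seq t [] u \<longleftrightarrow> t = u"
| "red_seq t ((r, t') # d) u \<longleftrightarrow> step r t t' \<and> red_seq t' d u"

definition beta_steps :: "(rule \<times> trm) list \<Rightarrow> nat" where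
  "beta_steps d = length (filter (\<lambda>(r, t). r = BetaV) d)"

lemma shuf_iff_step: "shuf t u \<longleftrightarrow> (\<exists>r. step r t u)"
  unfolding shuf_def by (metis rule.exhaust)

lemma shuf_rtranclp_iff_red_seq: "shuf\<^sup>*\<^sup>* t u \<longleftrightarrow> (\<exists>d. red_seq t d u)"
proof
  show "\<exists>d. red_seq t d u" if "shuf\<^sup>*\<^sup>* t u"
    using that
  proof (induction rule: converse_rtranclp_induct)
    case base
    have "red_seq u [] u" by simp
    then show ?case by blast
  next
    case (step t t')
    then obtain r d where "step r t t'" "red_seq t' d u"
      by (auto simp: shuf_iff_step)
    then have "red_seq t ((r, t') # d) u" by simp
    then show ?case by blast
  qed
next
  assume "\<exists>d. red_seq t d u"
  then obtain d where "red_seq t d u" ..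
  then show "shuf\<^sup>*\<^sup>* t u"
  proof (induction d arbitrary: t)
    case (Cons a d)
    then show ?case
      by (cases a) (auto simp: shuf_iff_step intro: converse_rtranclp_into_rtranclp)
  qed simp
qed

datatype ptype = PType "(ptype \<times> ptype) multiset"

text \<open>\<open>0\<close> is the empty positive type, \<open>+\<close> is multiset union.\<close>

instantiation ptype :: comm_monoid_add
begin

definition zero_ptype :: ptype where
  "0 = PType {#}"

fun plus_ptype :: "ptype \<Rightarrow> ptype \<Rightarrow> ptype" where
  "PType M + PType N = PType (M + N)"

instance
proof
  fix P Q R :: ptype
  show "P + Q + R = P + (Q + R)" by (cases P; cases Q; cases R) (simp add: add.assoc)
  show "P + Q = Q + P" by (cases P; cases Q) (simp add: add.commute)
  show "0 + P = P" by (cases P) (simp add: zero_ptype_def)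
qed

end

text \<open>
  Environments are added pointwise. Finite support need not be imposed: it holds in every
  derivable judgement, see \<open>derives_finite_support\<close> below.
\<close>

type_synonym env = "nat \<Rightarrow> ptype"

text \<open>
  Derivation trees. The node for \<open>\<lambda>\<close> has one subtree per premise; it also stores the body
  of the abstraction, which is not determined by the subtrees when there are none.
\<close>

datatype deriv = DAx nat ptype | DLam trm "deriv list" | DApp deriv deriv

text \<open>
  \<open>derives \<pi> \<Gamma> t P\<close> states that \<open>\<pi>\<close> is a derivation with conclusion \<open>\<Gamma> \<turnstile> t : P\<close>. The
  environment \<open>\<Gamma>, x : P\<close> with \<open>x\<close> the innermost bound variable is \<open>case_nat P \<Gamma>\<close>.
\<close>

inductive derives :: "deriv \<Rightarrow> env \<Rightarrow> trm \<Rightarrow> ptype \<Rightarrow> bool" where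
  ax: "derives (DAx x P) ((\<lambda>_. 0)(x := P)) (Var x) P"
| lam: "\<lbrakk>length \<Gamma>s = length \<pi>s; length Ps = length \<pi>s; length Qs = length \<pi>s;
    \<forall>i < length \<pi>s. derives (\<pi>s ! i) (case_nat (Ps ! i) (\<Gamma>s ! i)) t (Qs ! i)\<rbrakk>
    \<Longrightarrow> derives (DLam t \<pi>s) (sum_list \<Gamma>s) (Lam t) (PType (mset (zip Ps Qs)))"
| app: "\<lbrakk>derives \<pi> \<Gamma> t (PType {#(P, Q)#}); derives \<rho> \<Delta> u P\<rbrakk>
    \<Longrightarrow> derives (DApp \<pi> \<rho>) (\<Gamma> + \<Delta>) (App t u) Q"

primrec deriv_size :: "deriv \<Rightarrow> nat" where
  "deriv_size (DAx x P) = 0"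
| "deriv_size (DLam t \<pi>s) = sum_list (map deriv_size \<pi>s)"
| "deriv_size (DApp \<pi> \<rho>) = Suc (deriv_size \<pi> + deriv_size \<rho>)"

lemma finite_support_add:
  fixes \<Gamma> \<Delta> :: env
  assumes "finite {x. \<Gamma> x \<noteq> 0}" "finite {x. \<Delta> x \<noteq> 0}"
  shows "finite {x. (\<Gamma> + \<Delta>) x \<noteq> 0}"
  by (rule finite_subset[of _ "{x. \<Gamma> x \<noteq> 0} \<union> {x. \<Delta> x \<noteq> 0}"]) (use assms in auto)

lemma finite_support_sum_list:
  fixes \<Gamma>s :: "env list"
  assumes "\<And>\<Gamma>. \<Gamma> \<in> set \<Gamma>s \<Longrightarrow> finite {x. \<Gamma> x \<noteq> 0}"
  shows "finite {x. sum_list \<Gamma>s x \<noteq> 0}"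
  using assms by (induction \<Gamma>s) (auto intro: finite_support_add simp del: plus_fun_apply)

lemma derives_finite_support: "derives \<pi> \<Gamma> t P \<Longrightarrow> finite {x. \<Gamma> x \<noteq> 0}"
proof (induction rule: derives.induct)
  case (lam \<Gamma>s \<pi>s Ps Qs t)
  show ?case
  proof (rule finite_support_sum_list)
    fix \<Gamma> assume "\<Gamma> \<in> set \<Gamma>s"
    then obtain i where i: "i < length \<pi>s" "\<Gamma> = \<Gamma>s ! i"
      using lam by (metis in_set_conv_nth)
    with lam have "finite {x. case_nat (Ps ! i) \<Gamma> x \<noteq> 0}" by auto
    then have "finite (Suc -` {x. case_nat (Ps ! i) \<Gamma> x \<noteq> 0})"
      by (rule finite_vimageI) simp
    then show "finite {x. \<Gamma> x \<noteq> 0}" by (simp add: vimage_def)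
  qed
qed (auto intro: finite_support_add simp del: plus_fun_apply)

end

theory Submission
  imports Defs
begin

text \<open>
  Each \<open>\<beta>\<^sub>v\<close>-step removes exactly one application rule from a derivation, and the
  \<open>\<sigma>\<close>-steps preserve the number of application rules: a multiset type of a substituted value
  splits, together with its derivation, along the occurrences of the variable. A normal form
  typable in the empty environment is a value, because a variable applied to an argument
  needs a non-empty type in the environment; and a derivation that gives a value the empty
  type contains no application rule.
\<close>

text \<open>
  Typability with a given number of application rules. The \<open>\<lambda>\<close>-rule adds its premises one at
  a time, so that no list of premises has to be split.
\<close>

inductive typed :: "nat \<Rightarrow> env \<Rightarrow> trm \<Rightarrow> ptype \<Rightarrow> bool" where
  var: "typed 0 ((\<lambda>_. 0)(x := P)) (Var x) P"
| lam_zero: "typed 0 0 (Lam t) 0"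
| lam_add: "typed n (case_nat P \<Gamma>) t Q \<Longrightarrow> typed m \<Delta> (Lam t) R \<Longrightarrow>
    typed (n + m) (\<Gamma> + \<Delta>) (Lam t) (PType {#(P, Q)#} + R)"
| app: "typed n \<Gamma> t (PType {#(P, Q)#}) \<Longrightarrow> typed m \<Delta> u P \<Longrightarrow>
    typed (Suc (n + m)) (\<Gamma> + \<Delta>) (App t u) Q"

inductive_cases typed_VarE: "typed n \<Gamma> (Var x) P"
inductive_cases typed_LamE: "typed n \<Gamma> (Lam t) P"
inductive_cases typed_AppE: "typed n \<Gamma> (App t u) P"

section \<open>Sums of types and of environments\<close>

declare plus_fun_apply [simp del] zero_fun_apply [simp del] fun_upd_apply [simp del]

lemmas env_apply = plus_fun_apply zero_fun_apply fun_upd_apply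

lemma ptype_add_eq_0_iff [simp]: "P + Q = 0 \<longleftrightarrow> P = 0 \<and> Q = (0 :: ptype)"
  by (cases P; cases Q) (auto simp: zero_ptype_def)

text \<open>Nothing cancels in a sum of multisets. This is what passes emptiness of the environment
  from an application to both of its sides.\<close>

lemma env_add_eq_0_iff [simp]: "\<Gamma> + \<Delta> = 0 \<longleftrightarrow> \<Gamma> = 0 \<and> \<Delta> = (0 :: env)"
  by (auto simp: fun_eq_iff env_apply)

lemma PType_single_neq_0 [simp]: "PType {#p#} \<noteq> 0"
  by (simp add: zero_ptype_def)

lemma fun_upd_zero_0 [simp]: "(\<lambda>_. 0)(x := 0) = (0 :: env)"
  by (auto simp: fun_eq_iff env_apply)

lemma case_nat_add: "case_nat P \<Gamma> + case_nat Q \<Delta> = case_nat (P + Q) (\<Gamma> + \<Delta> :: env)"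
  by (auto simp: fun_eq_iff env_apply split: nat.splits)

section \<open>From derivation trees to counted typability\<close>

text \<open>Induction on the list of premises: each premise is one use of \<open>lam_add\<close>,
  and the empty list is \<open>lam_zero\<close>, since \<open>PType {#}\<close> is
  \<open>0\<close>.\<close>

lemma typed_Lam_list:
  assumes "length \<Gamma>s = length \<pi>s" "length Ps = length \<pi>s" "length Qs = length \<pi>s"
    and "\<forall>i < length \<pi>s. typed (deriv_size (\<pi>s ! i)) (case_nat (Ps ! i) (\<Gamma>s ! i)) t (Qs ! i)"
  shows "typed (sum_list (map deriv_size \<pi>s)) (sum_list \<Gamma>s) (Lam t) (PType (mset (zip Ps Qs)))"
  using assms
proof (induction \<pi>s arbitrary: \<Gamma>s Ps Qs)
  case Nil
  then show ?case using lam_zero by (simp add: zero_ptype_def)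
next
  case (Cons \<pi> \<pi>s)
  then obtain \<Gamma> \<Gamma>s' P Ps' Q Qs' where eqs: "\<Gamma>s = \<Gamma> # \<Gamma>s'" "Ps = P # Ps'" "Qs = Q # Qs'"
    by (metis length_Suc_conv)
  have hd: "typed (deriv_size \<pi>) (case_nat P \<Gamma>) t Q"
    using Cons.prems(4)[rule_format, of 0] by (simp add: eqs)
  have tl: "typed (sum_list (map deriv_size \<pi>s)) (sum_list \<Gamma>s') (Lam t)
      (PType (mset (zip Ps' Qs')))"
  proof (intro Cons.IH allI impI)
    fix i assume "i < length \<pi>s"
    then show "typed (deriv_size (\<pi>s ! i)) (case_nat (Ps' ! i) (\<Gamma>s' ! i)) t (Qs' ! i)"
      using Cons.prems(4)[rule_format, of "Suc i"] by (simp add: eqs)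
  qed (use Cons.prems in \<open>simp_all add: eqs\<close>)
  show ?case
    using lam_add[OF hd tl] by (simp add: eqs)
qed

lemma derives_imp_typed: "derives \<pi> \<Gamma> t P \<Longrightarrow> typed (deriv_size \<pi>) \<Gamma> t P"
proof (induction rule: derives.induct)
  case (lam \<Gamma>s \<pi>s Ps Qs t)
  then show ?case by (simp add: typed_Lam_list)
qed (auto intro: typed.intros)

section \<open>Inversion and splitting for values\<close>

text \<open>A singleton leaves room for one use of \<open>lam_add\<close> only. What remains is an
  abstraction of type \<open>0\<close>, which adds nothing to the counter or to the
  environment.\<close>

lemma typed_Lam_single:
  assumes "typed n \<Gamma> (Lam t) (PType {#(P, Q)#})"
  shows "typed n (case_nat P \<Gamma>) t Q"
proof -
  from assms obtain n' P' \<Gamma>' Q' m \<Delta> R where eqs: "n = n' + m" "\<Gamma> = \<Gamma>' + \<Delta>"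
      "PType {#(P, Q)#} = PType {#(P', Q')#} + R"
    and body: "typed n' (case_nat P' \<Gamma>') t Q'" and rest: "typed m \<Delta> (Lam t) R"
    by (auto elim: typed_LamE)
  from eqs(3) have "P' = P" "Q' = Q" "R = 0"
    by (cases R; simp add: zero_ptype_def)+
  moreover from rest \<open>R = 0\<close> have "m = 0" "\<Delta> = 0"
    by (auto elim: typed_LamE)
  ultimately show ?thesis using body eqs by simp
qed

lemma typed_value_0:
  assumes "typed n \<Gamma> v 0" "is_value v"
  shows "n = 0" "\<Gamma> = 0"
  using assms by (cases v; auto elim: typed_VarE typed_LamE)+

lemma single_add_eq_add_cases:
  fixes R A B :: ptype
  assumes "PType {#p#} + R = A + B"
  obtains A' where "A = PType {#p#} + A'" "R = A' + B"
  | B' where "B = PType {#p#} + B'" "R = A + B'"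
proof -
  obtain X Y Z where X: "R = PType X" "A = PType Y" "B = PType Z"
    by (metis ptype.exhaust)
  with assms have eq: "add_mset p X = Y + Z" by simp
  then have "p \<in># Y + Z" by (metis union_single_eq_member)
  then consider "p \<in># Y" | "p \<in># Z" by auto
  then show thesis
  proof cases
    case 1
    then obtain Y' where "Y = add_mset p Y'" by (metis mset_add)
    then show thesis using eq X that(1)[of "PType Y'"] by simp
  next
    case 2
    then obtain Z' where "Z = add_mset p Z'" by (metis mset_add)
    then show thesis using eq X that(2)[of "PType Z'"] by simp
  qed
qed

text \<open>Each pair in the type of an abstraction has its own premise, so the premises can be
  sorted into those for \<open>A\<close> and those for \<open>B\<close>; an axiom splits into two
  axioms. Substitution uses this to share out one typing of a value among the copies of it.\<close>

lemma typed_value_split: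
  assumes "typed n \<Gamma> v (A + B)" "is_value v"
  obtains n\<^sub>1 n\<^sub>2 \<Gamma>\<^sub>1 \<Gamma>\<^sub>2 where "n = n\<^sub>1 + n\<^sub>2" "\<Gamma> = \<Gamma>\<^sub>1 + \<Gamma>\<^sub>2" "typed n\<^sub>1 \<Gamma>\<^sub>1 v A" "typed n\<^sub>2 \<Gamma>\<^sub>2 v B"
proof -
  have "\<exists>n\<^sub>1 n\<^sub>2 \<Gamma>\<^sub>1 \<Gamma>\<^sub>2. n = n\<^sub>1 + n\<^sub>2 \<and> \<Gamma> = \<Gamma>\<^sub>1 + \<Gamma>\<^sub>2 \<and> typed n\<^sub>1 \<Gamma>\<^sub>1 v A \<and> typed n\<^sub>2 \<Gamma>\<^sub>2 v B"
    using assms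
  proof (induction n \<Gamma> v "A + B" arbitrary: A B rule: typed.induct)
    case (var x)
    have "(\<lambda>_. 0)(x := A + B) = (\<lambda>_. 0)(x := A) + ((\<lambda>_. 0)(x := B) :: env)"
      by (auto simp: fun_eq_iff env_apply)
    then show ?case using typed.var by (metis add_0)
  next
    case (lam_zero t)
    then have "A = 0" "B = 0" by (metis ptype_add_eq_0_iff)+
    then show ?case using typed.lam_zero by (metis add_0)
  next
    case (lam_add n P \<Gamma> t Q m \<Delta> R)
    \<comment> \<open>The pair of the newest premise belongs to \<open>A\<close> or to
      \<open>B\<close>. The induction hypothesis splits the other premises, and the newest one joins
      the side of its pair.\<close>
    from lam_add.hyps(5) show ?case
    proof (cases rule: single_add_eq_add_cases)
      case (1 A')
      then obtain n\<^sub>1 n\<^sub>2 \<Gamma>\<^sub>1 \<Gamma>\<^sub>2 where "m = n\<^sub>1 + n\<^sub>2" "\<Delta> = \<Gamma>\<^sub>1 + \<Gamma>\<^sub>2"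
          "typed n\<^sub>1 \<Gamma>\<^sub>1 (Lam t) A'" "typed n\<^sub>2 \<Gamma>\<^sub>2 (Lam t) B"
        using lam_add.hyps(4) by fastforce
      with 1 typed.lam_add[OF lam_add.hyps(1) this(3)] show ?thesis
        by (intro exI[of _ "n + n\<^sub>1"] exI[of _ n\<^sub>2] exI[of _ "\<Gamma> + \<Gamma>\<^sub>1"] exI[of _ \<Gamma>\<^sub>2])
          (simp add: add.assoc)
    next
      case (2 B')
      then obtain n\<^sub>1 n\<^sub>2 \<Gamma>\<^sub>1 \<Gamma>\<^sub>2 where "m = n\<^sub>1 + n\<^sub>2" "\<Delta> = \<Gamma>\<^sub>1 + \<Gamma>\<^sub>2"
          "typed n\<^sub>1 \<Gamma>\<^sub>1 (Lam t) A" "typed n\<^sub>2 \<Gamma>\<^sub>2 (Lam t) B'"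
        using lam_add.hyps(4) by fastforce
      with 2 typed.lam_add[OF lam_add.hyps(1) this(4)] show ?thesis
        by (intro exI[of _ n\<^sub>1] exI[of _ "n + n\<^sub>2"] exI[of _ \<Gamma>\<^sub>1] exI[of _ "\<Gamma> + \<Gamma>\<^sub>2"])
          (simp add: add.left_commute)
    qed
  qed simp
  then show thesis using that by blast
qed

section \<open>Lifting and substitution\<close>

definition env_insert0 :: "nat \<Rightarrow> env \<Rightarrow> env" where
  "env_insert0 k \<Gamma> i = (if i < k then \<Gamma> i else if i = k then 0 else \<Gamma> (i - 1))"

definition env_remove :: "nat \<Rightarrow> env \<Rightarrow> env" where
  "env_remove k \<Gamma> i = (if i < k then \<Gamma> i else \<Gamma> (Suc i))"

text \<open>\<open>env_insert0 k\<close> and \<open>env_remove k\<close> follow on environments what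
  \<open>lift k\<close> and \<open>subst\<close> at \<open>k\<close> do to indices. Both commute
  with the operations that build environments in the typing rules, so inductions on
  \<open>typed\<close> reduce to simplification.\<close>

lemma env_insert0_simps [simp]:
  "env_insert0 k 0 = 0"
  "env_insert0 k (\<Gamma> + \<Delta>) = env_insert0 k \<Gamma> + env_insert0 k \<Delta>"
  "env_insert0 (Suc k) (case_nat P \<Gamma>) = case_nat P (env_insert0 k \<Gamma>)"
  "env_insert0 0 \<Gamma> = case_nat 0 \<Gamma>"
  "env_insert0 k ((\<lambda>_. 0)(x := P)) = (\<lambda>_. 0)((if x < k then x else Suc x) := P)"
  by (auto simp: fun_eq_iff env_apply env_insert0_def split: nat.splits)

lemma env_remove_simps [simp]:
  "env_remove k 0 = 0"
  "env_remove k (\<Gamma> + \<Delta>) = env_remove k \<Gamma> + env_remove k \<Delta>"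
  "env_remove (Suc k) (case_nat P \<Gamma>) = case_nat P (env_remove k \<Gamma>)"
  "env_remove 0 (case_nat P \<Gamma>) = \<Gamma>"
  "env_remove k ((\<lambda>_. 0)(x := P)) =
    (if x = k then 0 else (\<lambda>_. 0)((if k < x then x - 1 else x) := P))"
  by (auto simp: fun_eq_iff env_apply env_remove_def split: nat.splits)

lemma typed_lift: "typed n \<Gamma> t P \<Longrightarrow> typed n (env_insert0 k \<Gamma>) (lift k t) P"
proof (induction arbitrary: k rule: typed.induct)
  case (lam_add n P \<Gamma> t Q m \<Delta> R)
  have "typed n (case_nat P (env_insert0 k \<Gamma>)) (lift (Suc k) t) Q"
    using lam_add.IH(1)[of "Suc k"] by simp
  then show ?case using typed.lam_add lam_add.IH(2)[of k] by simp
qed (auto intro: typed.intros)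

lemma typed_lift0: "typed n \<Gamma> t P \<Longrightarrow> typed n (case_nat 0 \<Gamma>) (lift 0 t) P"
  using typed_lift[of n \<Gamma> t P 0] by simp

lemma is_value_lift [simp]: "is_value (lift k v) = is_value v"
  by (cases v) auto

text \<open>The value is typed with exactly the type that \<open>\<Gamma>\<close> assigns to index
  \<open>k\<close>. Its typing is divided among the uses of \<open>k\<close>, and each piece
  replaces an axiom. Axioms count zero, so the counters simply add.\<close>

lemma typed_subst:
  assumes "typed n \<Gamma> t Q" "typed m \<Delta> v (\<Gamma> k)" "is_value v"
  shows "typed (n + m) (env_remove k \<Gamma> + \<Delta>) (subst t v k) Q"
  using assms
proof (induction arbitrary: m \<Delta> v k rule: typed.induct)
  case (var x P)
  show ?case
  proof (cases "x = k")
    case True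
    with var have "typed m \<Delta> v P" by (simp add: fun_upd_apply)
    with True show ?thesis by simp
  next
    case False
    \<comment> \<open>Another variable demands type \<open>0\<close> from the value, so the
      discarded copy costs nothing. The same holds below for an abstraction without
      premises.\<close>
    with var have "typed m \<Delta> v 0" by (simp add: env_apply)
    with var have "m = 0" "\<Delta> = 0" using typed_value_0 by blast+
    with False show ?thesis using typed.var by simp
  qed
next
  case (lam_zero t)
  then have "m = 0" "\<Delta> = 0" using typed_value_0[of m \<Delta> v] by (simp_all add: zero_fun_apply)
  then show ?case using typed.lam_zero by simp
next
  case (lam_add n P \<Gamma> t Q m \<Delta> R m' \<Delta>')
  from lam_add.prems obtain n\<^sub>1 n\<^sub>2 \<Gamma>\<^sub>1 \<Gamma>\<^sub>2 where split: "m' = n\<^sub>1 + n\<^sub>2" "\<Delta>' = \<Gamma>\<^sub>1 + \<Gamma>\<^sub>2"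
      "typed n\<^sub>1 \<Gamma>\<^sub>1 v (\<Gamma> k)" "typed n\<^sub>2 \<Gamma>\<^sub>2 v (\<Delta> k)"
    by (auto simp: plus_fun_apply elim: typed_value_split)
  \<comment> \<open>The lifted value has type \<open>0\<close> at the new index in its environment,
    so the bound variable keeps type \<open>P\<close>.\<close>
  have "typed (n + n\<^sub>1) (case_nat P (env_remove k \<Gamma> + \<Gamma>\<^sub>1)) (subst t (lift 0 v) (Suc k)) Q"
    using lam_add.IH(1)[of n\<^sub>1 "case_nat 0 \<Gamma>\<^sub>1" "lift 0 v" "Suc k"] split(3) lam_add.prems(2)
    by (simp add: typed_lift0 case_nat_add)
  moreover have "typed (m + n\<^sub>2) (env_remove k \<Delta> + \<Gamma>\<^sub>2) (Lam (subst t (lift 0 v) (Suc k))) R"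
    using lam_add.IH(2)[OF split(4)] lam_add.prems(2) by simp
  ultimately show ?case
    using typed.lam_add split(1,2) by (fastforce simp: ac_simps)
next
  case (app n \<Gamma> t P Q m \<Delta> u m' \<Delta>')
  from app.prems obtain n\<^sub>1 n\<^sub>2 \<Gamma>\<^sub>1 \<Gamma>\<^sub>2 where split: "m' = n\<^sub>1 + n\<^sub>2" "\<Delta>' = \<Gamma>\<^sub>1 + \<Gamma>\<^sub>2"
      "typed n\<^sub>1 \<Gamma>\<^sub>1 v (\<Gamma> k)" "typed n\<^sub>2 \<Gamma>\<^sub>2 v (\<Delta> k)"
    by (auto simp: plus_fun_apply elim: typed_value_split)
  show ?case
    using typed.app[OF app.IH(1)[OF split(3) app.prems(2)] app.IH(2)[OF split(4) app.prems(2)]]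
    by (simp add: split ac_simps)
qed

section \<open>Exact effect of a step on the counter\<close>

text \<open>An applied abstraction has a singleton type, so its body is typed exactly once. This
  covers the redexes and the balanced contexts that enter an abstraction.\<close>

lemma typed_App_Lam_iff:
  "typed n \<Gamma> (App (Lam t) u) Q \<longleftrightarrow> (\<exists>n\<^sub>1 n\<^sub>2 \<Gamma>\<^sub>1 \<Gamma>\<^sub>2 P. n = Suc (n\<^sub>1 + n\<^sub>2) \<and> \<Gamma> = \<Gamma>\<^sub>1 + \<Gamma>\<^sub>2 \<and>
    typed n\<^sub>1 (case_nat P \<Gamma>\<^sub>1) t Q \<and> typed n\<^sub>2 \<Gamma>\<^sub>2 u P)"
proof
  assume "typed n \<Gamma> (App (Lam t) u) Q"
  then show "\<exists>n\<^sub>1 n\<^sub>2 \<Gamma>\<^sub>1 \<Gamma>\<^sub>2 P. n = Suc (n\<^sub>1 + n\<^sub>2) \<and> \<Gamma> = \<Gamma>\<^sub>1 + \<Gamma>\<^sub>2 \<and>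
      typed n\<^sub>1 (case_nat P \<Gamma>\<^sub>1) t Q \<and> typed n\<^sub>2 \<Gamma>\<^sub>2 u P"
    by (elim typed_AppE) (blast dest: typed_Lam_single)
next
  have "typed n (\<Gamma> + 0) (Lam t) (PType {#(P, Q)#} + 0)" if "typed n (case_nat P \<Gamma>) t Q"
    for n P \<Gamma>
    using lam_add[OF that lam_zero] by simp
  moreover assume "\<exists>n\<^sub>1 n\<^sub>2 \<Gamma>\<^sub>1 \<Gamma>\<^sub>2 P. n = Suc (n\<^sub>1 + n\<^sub>2) \<and> \<Gamma> = \<Gamma>\<^sub>1 + \<Gamma>\<^sub>2 \<and>
      typed n\<^sub>1 (case_nat P \<Gamma>\<^sub>1) t Q \<and> typed n\<^sub>2 \<Gamma>\<^sub>2 u P"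
  ultimately show "typed n \<Gamma> (App (Lam t) u) Q"
    by (auto intro: app)
qed

definition rule_cost :: "rule \<Rightarrow> nat" where
  "rule_cost r = (if r = BetaV then 1 else 0)"

text \<open>For \<open>BetaV\<close> the application rule of the redex disappears, and substitution
  preserves the total of the rest. In a \<sigma>-step both application rules survive, and the same
  three subderivations are regrouped around them.\<close>

lemma typed_root:
  assumes "root r t u" "typed n \<Gamma> t Q"
  shows "\<exists>m. n = m + rule_cost r \<and> typed m \<Gamma> u Q"
  using assms
proof (induction rule: root.induct)
  case (beta_v v t)
  then obtain n\<^sub>1 n\<^sub>2 \<Gamma>\<^sub>1 \<Gamma>\<^sub>2 P where *: "n = Suc (n\<^sub>1 + n\<^sub>2)" "\<Gamma> = \<Gamma>\<^sub>1 + \<Gamma>\<^sub>2"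
      "typed n\<^sub>1 (case_nat P \<Gamma>\<^sub>1) t Q" "typed n\<^sub>2 \<Gamma>\<^sub>2 v P"
    by (auto simp: typed_App_Lam_iff)
  have "typed (n\<^sub>1 + n\<^sub>2) \<Gamma> (subst t v 0) Q"
    using typed_subst[OF *(3), of n\<^sub>2 \<Gamma>\<^sub>2 v 0] *(2,4) beta_v.hyps by simp
  with *(1) show ?case by (auto simp: rule_cost_def)
next
  case (sigma1 t u s)
  then obtain n\<^sub>1 n\<^sub>2 n\<^sub>3 \<Gamma>\<^sub>1 \<Gamma>\<^sub>2 \<Gamma>\<^sub>3 P R where *: "n = Suc (Suc (n\<^sub>1 + n\<^sub>2) + n\<^sub>3)"
      "\<Gamma> = \<Gamma>\<^sub>1 + \<Gamma>\<^sub>2 + \<Gamma>\<^sub>3" "typed n\<^sub>1 (case_nat P \<Gamma>\<^sub>1) t (PType {#(R, Q)#})"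
      "typed n\<^sub>2 \<Gamma>\<^sub>2 u P" "typed n\<^sub>3 \<Gamma>\<^sub>3 s R"
    by (elim typed_AppE[of _ _ "App (Lam t) u"]) (auto simp: typed_App_Lam_iff)
  \<comment> \<open>The side condition that the bound variable is not free in \<open>s\<close>
    enters here: \<open>lift 0 s\<close> assigns it type \<open>0\<close>, so its type in the new
    body is still \<open>P\<close>. The case of \<open>sigma3\<close> treats \<open>v\<close>
    alike.\<close>
  have "typed (Suc (n\<^sub>1 + n\<^sub>3)) (case_nat P (\<Gamma>\<^sub>1 + \<Gamma>\<^sub>3)) (App t (lift 0 s)) Q"
    using app[OF *(3) typed_lift0[OF *(5)]] by (simp add: case_nat_add)
  moreover have "n = Suc (Suc (n\<^sub>1 + n\<^sub>3) + n\<^sub>2)" "\<Gamma> = (\<Gamma>\<^sub>1 + \<Gamma>\<^sub>3) + \<Gamma>\<^sub>2"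
    using *(1,2) by (simp_all add: ac_simps)
  ultimately have "typed n \<Gamma> (App (Lam (App t (lift 0 s))) u) Q"
    using *(4) unfolding typed_App_Lam_iff by blast
  then show ?case by (simp add: rule_cost_def)
next
  case (sigma3 v s u)
  then obtain n\<^sub>1 n\<^sub>2 n\<^sub>3 \<Gamma>\<^sub>1 \<Gamma>\<^sub>2 \<Gamma>\<^sub>3 P R where *: "n = Suc (n\<^sub>3 + Suc (n\<^sub>1 + n\<^sub>2))"
      "\<Gamma> = \<Gamma>\<^sub>3 + (\<Gamma>\<^sub>1 + \<Gamma>\<^sub>2)" "typed n\<^sub>1 (case_nat P \<Gamma>\<^sub>1) s R"
      "typed n\<^sub>2 \<Gamma>\<^sub>2 u P" "typed n\<^sub>3 \<Gamma>\<^sub>3 v (PType {#(R, Q)#})"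
    by (elim typed_AppE[of _ _ v]) (auto simp: typed_App_Lam_iff)
  have "typed (Suc (n\<^sub>3 + n\<^sub>1)) (case_nat P (\<Gamma>\<^sub>3 + \<Gamma>\<^sub>1)) (App (lift 0 v) s) Q"
    using app[OF typed_lift0[OF *(5)] *(3)] by (simp add: case_nat_add)
  moreover have "n = Suc (Suc (n\<^sub>3 + n\<^sub>1) + n\<^sub>2)" "\<Gamma> = (\<Gamma>\<^sub>3 + \<Gamma>\<^sub>1) + \<Gamma>\<^sub>2"
    using *(1,2) by (simp_all add: ac_simps)
  ultimately have "typed n \<Gamma> (App (Lam (App (lift 0 v) s)) u) Q"
    using *(4) unfolding typed_App_Lam_iff by blast
  then show ?case by (simp add: rule_cost_def)
qed

text \<open>A balanced context enters an abstraction only if it is applied, so a derivation types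
  the hole exactly once, and the change at the root is the change of the whole. Under an arbitrary
  abstraction the hole could be typed any number of times.\<close>

lemma typed_plug:
  assumes "root r s s'" "typed n \<Gamma> (plug B s) Q"
  shows "\<exists>m. n = m + rule_cost r \<and> typed m \<Gamma> (plug B s') Q"
  using assms(2)
proof (induction B arbitrary: n \<Gamma> Q)
  case Hole
  then show ?case using typed_root[OF assms(1)] by simp
next
  case (BLam B t)
  then obtain n\<^sub>1 n\<^sub>2 \<Gamma>\<^sub>1 \<Gamma>\<^sub>2 P where *: "n = Suc (n\<^sub>1 + n\<^sub>2)" "\<Gamma> = \<Gamma>\<^sub>1 + \<Gamma>\<^sub>2"
      "typed n\<^sub>1 (case_nat P \<Gamma>\<^sub>1) (plug B s) Q" "typed n\<^sub>2 \<Gamma>\<^sub>2 t P"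
    by (auto simp: typed_App_Lam_iff)
  from BLam.IH[OF *(3)] obtain m where "n\<^sub>1 = m + rule_cost r"
      "typed m (case_nat P \<Gamma>\<^sub>1) (plug B s') Q"
    by blast
  with * have "typed (Suc (m + n\<^sub>2)) \<Gamma> (plug (BLam B t) s') Q"
      "n = Suc (m + n\<^sub>2) + rule_cost r"
    unfolding plug.simps typed_App_Lam_iff by (blast, simp)
  then show ?case by blast
next
  case (BAppL B t)
  then obtain n\<^sub>1 n\<^sub>2 \<Gamma>\<^sub>1 \<Gamma>\<^sub>2 P where *: "n = Suc (n\<^sub>1 + n\<^sub>2)" "\<Gamma> = \<Gamma>\<^sub>1 + \<Gamma>\<^sub>2"
      "typed n\<^sub>1 \<Gamma>\<^sub>1 (plug B s) (PType {#(P, Q)#})" "typed n\<^sub>2 \<Gamma>\<^sub>2 t P"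
    by (auto elim: typed_AppE)
  from BAppL.IH[OF *(3)] obtain m where "n\<^sub>1 = m + rule_cost r"
      "typed m \<Gamma>\<^sub>1 (plug B s') (PType {#(P, Q)#})"
    by blast
  with * have "typed (Suc (m + n\<^sub>2)) \<Gamma> (plug (BAppL B t) s') Q"
      "n = Suc (m + n\<^sub>2) + rule_cost r"
    by (auto intro: app)
  then show ?case by blast
next
  case (BAppR t B)
  then obtain n\<^sub>1 n\<^sub>2 \<Gamma>\<^sub>1 \<Gamma>\<^sub>2 P where *: "n = Suc (n\<^sub>1 + n\<^sub>2)" "\<Gamma> = \<Gamma>\<^sub>1 + \<Gamma>\<^sub>2"
      "typed n\<^sub>1 \<Gamma>\<^sub>1 t (PType {#(P, Q)#})" "typed n\<^sub>2 \<Gamma>\<^sub>2 (plug B s) P"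
    by (auto elim: typed_AppE)
  from BAppR.IH[OF *(4)] obtain m where "n\<^sub>2 = m + rule_cost r"
      "typed m \<Gamma>\<^sub>2 (plug B s') P"
    by blast
  with * have "typed (Suc (n\<^sub>1 + m)) \<Gamma> (plug (BAppR t B) s') Q"
      "n = Suc (n\<^sub>1 + m) + rule_cost r"
    by (auto intro: app)
  then show ?case by blast
qed

lemma typed_red_seq:
  assumes "red_seq t d u" "typed n \<Gamma> t Q"
  shows "\<exists>m. n = m + beta_steps d \<and> typed m \<Gamma> u Q"
  using assms
proof (induction d arbitrary: t n)
  case Nil
  then show ?case by (simp add: beta_steps_def)
next
  case (Cons s d)
  obtain r t' where s: "s = (r, t')" by (cases s)
  with Cons.prems obtain m where "n = m + rule_cost r" "typed m \<Gamma> t' Q"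
    by (auto simp: step_def dest: typed_plug)
  with Cons s show ?case
    by (fastforce simp: beta_steps_def rule_cost_def)
qed

section \<open>Closed typable normal forms\<close>

lemma shuf_normal_AppD:
  assumes "shuf_normal (App t u)"
  shows "shuf_normal t" "shuf_normal u"
proof -
  have "shuf (App t u) (App t' u)" if "shuf t t'" for t'
    using that unfolding shuf_iff_step step_def by (metis plug.simps(3))
  then show "shuf_normal t" using assms by (auto simp: shuf_normal_def)
  have "shuf (App t u) (App t u')" if "shuf u u'" for u'
    using that unfolding shuf_iff_step step_def by (metis plug.simps(4))
  then show "shuf_normal u" using assms by (auto simp: shuf_normal_def)
qed

lemma not_shuf_normal_beta: "is_value v \<Longrightarrow> \<not> shuf_normal (App (Lam t) v)"
  unfolding shuf_normal_def shuf_def step_def by (metis beta_v plug.simps(1))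

text \<open>By induction both sides of a closed typable normal application are values. The left one
  cannot be a variable, so it is an abstraction, and the application is a
  \<open>BetaV\<close>-redex.\<close>

lemma closed_typed_normal_is_value:
  "typed n 0 t P \<Longrightarrow> shuf_normal t \<Longrightarrow> is_value t"
proof (induction t arbitrary: n P)
  case (App t u)
  from App.prems(1) obtain n\<^sub>1 n\<^sub>2 \<Gamma>\<^sub>1 \<Gamma>\<^sub>2 Q where "0 = \<Gamma>\<^sub>1 + \<Gamma>\<^sub>2"
      "typed n\<^sub>1 \<Gamma>\<^sub>1 t (PType {#(Q, P)#})" "typed n\<^sub>2 \<Gamma>\<^sub>2 u Q"
    by (auto elim: typed_AppE)
  moreover from this(1) have "\<Gamma>\<^sub>1 = 0" "\<Gamma>\<^sub>2 = 0" by (metis env_add_eq_0_iff)+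
  ultimately have t: "typed n\<^sub>1 0 t (PType {#(Q, P)#})" and u: "typed n\<^sub>2 0 u Q" by simp_all
  have "is_value t" "is_value u"
    using App.IH t u shuf_normal_AppD[OF App.prems(2)] by blast+
  moreover have "t \<noteq> Var x" for x
  proof
    assume "t = Var x"
    \<comment> \<open>The axiom forces the environment to hold the type of \<open>x\<close>, and a
      function type is a nonempty multiset.\<close>
    with t have "(0 :: env) = (\<lambda>_. 0)(x := PType {#(Q, P)#})" by (auto elim: typed_VarE)
    then have "0 = PType {#(Q, P)#}" by (metis fun_upd_same zero_fun_apply)
    then show False by (simp add: zero_ptype_def)
  qed
  ultimately show ?case
    using App.prems(2) not_shuf_normal_beta by (cases t) auto
qed simp_all

theorem mainTheorem3:
  fixes t v :: trm
  assumes "shuf\<^sup>*\<^sup>* t v" and "is_value v"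
  shows "\<forall>\<pi> d u. derives \<pi> (\<lambda>_. 0) t 0 \<longrightarrow> red_seq t d u \<longrightarrow> shuf_normal u \<longrightarrow>
    beta_steps d = deriv_size \<pi>"
proof (intro allI impI)
  fix \<pi> d u
  assume "derives \<pi> (\<lambda>_. 0) t 0" and red: "red_seq t d u" and normal: "shuf_normal u"
  then have "typed (deriv_size \<pi>) 0 t 0"
    using derives_imp_typed by (fastforce simp: zero_fun_def)
  from typed_red_seq[OF red this] obtain m
    where m: "deriv_size \<pi> = m + beta_steps d" "typed m 0 u 0" by blast
  \<comment> \<open>The count \<open>m\<close> left after the reduction is that of a value of type
    \<open>0\<close>.\<close>
  moreover have "m = 0"
    using typed_value_0(1)[OF m(2)] closed_typed_normal_is_value[OF m(2) normal] by simp
  ultimately show "beta_steps d = deriv_size \<pi>" by simp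
qed

end
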